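(* $\mathcal{EM}\cap\mathscr{B}=\mathfrak{P}_2\cap\mathscr{B}$.
   Context: $2^\omega$ is the Cantor space, $[\omega]^\omega$ is the family of infinite subsets of $\omega$, and $\mathscr{B}$ is the class of all Borel subsets of $2^\omega$. For $S\in[\omega]^\omega$, $2^S$ carries the product topology. For $X\subseteq 2^\omega$, $X\restriction S=\{x\restriction S:x\in X\}\subseteq 2^S$. Define $\mathcal{EM}=\{X\subseteq 2^\omega:(\forall S\in[\omega]^\omega)\ X\restriction S\text{ is meager in }2^S\}$ and $\mathfrak{P}_2=\{X\subseteq 2^\omega:(\forall S\in[\omega]^\omega)\ X\restriction S\neq 2^S\}$. *)

theory Defs
  imports "HOL-Analysis.Analysis"
begin

text \<open>
  The Cantor space is the type \<^typ>\<open>nat \<Rightarrow> bool\<close> with its type class topology, so its Borel sets are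
  \<open>sets borel\<close>.  For a set \<open>S\<close> of naturals, a function on \<open>S\<close> is represented by its extension with
  value \<^term>\<open>undefined\<close> outside \<open>S\<close>, as produced by \<^const>\<open>restrict\<close>.
\<close>

definition two_pow :: "nat set \<Rightarrow> (nat \<Rightarrow> bool) topology"
  where "two_pow S = product_topology (\<lambda>_. discrete_topology UNIV) S"

lemma topspace_two_pow: "topspace (two_pow S) = (\<Pi>\<^sub>E i\<in>S. UNIV)"
  by (simp add: two_pow_def)

lemma two_pow_UNIV: "two_pow UNIV = euclidean"
proof -
  have "discrete_topology UNIV = (euclidean :: bool topology)"
    by (simp add: topology_eq open_discrete)
  then show ?thesis
    by (simp add: two_pow_def euclidean_product_topology)
qed

definition restr :: "(nat \<Rightarrow> bool) set \<Rightarrow> nat set \<Rightarrow> (nat \<Rightarrow> bool) set"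
  where "restr X S = (\<lambda>x. restrict x S) ` X"

definition nowhere_dense_in :: "'a topology \<Rightarrow> 'a set \<Rightarrow> bool"
  where "nowhere_dense_in T A \<longleftrightarrow> A \<subseteq> topspace T \<and> T interior_of (T closure_of A) = {}"

definition meager_in :: "'a topology \<Rightarrow> 'a set \<Rightarrow> bool"
  where "meager_in T A \<longleftrightarrow> (\<exists>F. countable F \<and> (\<forall>N\<in>F. nowhere_dense_in T N) \<and> A = \<Union>F)"

definition EM :: "(nat \<Rightarrow> bool) set set"
  where "EM = {X. \<forall>S. infinite S \<longrightarrow> meager_in (two_pow S) (restr X S)}"

definition P2 :: "(nat \<Rightarrow> bool) set set"
  where "P2 = {X. \<forall>S. infinite S \<longrightarrow> restr X S \<noteq> topspace (two_pow S)}"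

end

theory Submission
  imports Defs
begin

text \<open>
  Every full power \<open>2\<^sup>S\<close> with \<open>S\<close> infinite is nonmeager in itself, so \<open>EM \<subseteq> P2\<close>.  Conversely let
  \<open>X\<close> be a Borel set whose restriction to some infinite \<open>S\<close> is nonmeager; an infinite \<open>T \<subseteq> S\<close> is
  needed with \<open>X\<restriction>T = 2\<^sup>T\<close>.  Two facts combine.

  First, \<open>X\<restriction>S\<close> is a projection of a closed set, so it has the Baire property, and being nonmeager it
  is comeager in some cylinder (lemma \<open>analytic_comeager_in_cyl\<close>).  The proof is Nikodym's: write
  \<open>X\<close> as the projection of a closed \<open>C \<subseteq> 2\<^sup>\<omega> \<times> \<omega>\<^sup>\<omega>\<close>, let \<open>A s\<close> be the projection of the part of \<open>C\<close>
  whose second coordinate extends the finite sequence \<open>s\<close>, and replace \<open>A s\<close> by the open set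
  \<open>heavy S (A s)\<close> of points near which it is nonmeager in every cylinder.  Outside a meager set,
  \<open>x \<in> heavy S (A s)\<close> implies \<open>x \<in> heavy S (A (s @ [n]))\<close> for some \<open>n\<close>.  The resulting branch
  \<open>z \<in> \<omega>\<^sup>\<omega>\<close>, together with compactness of \<open>2\<^sup>\<omega>\<close>, yields \<open>y\<close> with \<open>(y, z) \<in> C\<close> that agrees with
  \<open>x\<close> on \<open>S\<close>.

  Second, a comeager subset of a cylinder of \<open>2\<^sup>S\<close> maps onto \<open>2\<^sup>T\<close> for some infinite \<open>T \<subseteq> S\<close>
  (lemma \<open>comeager_contains_cube\<close>).  Choose the elements of \<open>T\<close> one at a time, and after each choice
  fix a finite block of the other coordinates so that the next nowhere dense set is avoided whatever
  the values on earlier coordinates are.  The values on \<open>T\<close> remain free.  Applied to the whole space,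
  this is also the Baire category theorem that the first inclusion requires.
\<close>

section \<open>Category modulo coordinates outside a set\<close>

text \<open>
  Restricting to \<open>S\<close> is the same as ignoring the coordinates outside \<open>S\<close>.  Category in \<open>2\<^sup>S\<close> is
  therefore studied for sets of total functions, with cylinders that constrain only coordinates in
  \<open>S\<close>.  Such a cylinder is named by a list whose entries at positions outside \<open>S\<close> are irrelevant;
  this keeps the names countable and independent of \<open>S\<close>.
\<close>

definition cyl :: "nat set \<Rightarrow> bool list \<Rightarrow> (nat \<Rightarrow> bool) set"
  where "cyl S l = {x. \<forall>i<length l. i \<in> S \<longrightarrow> x i = l ! i}"

definition nowhere_dense_on :: "nat set \<Rightarrow> (nat \<Rightarrow> bool) set \<Rightarrow> bool"
  where "nowhere_dense_on S N \<longleftrightarrow> (\<forall>l. \<exists>l'. cyl S l' \<subseteq> cyl S l \<and> N \<inter> cyl S l' = {})"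

definition meager_on :: "nat set \<Rightarrow> (nat \<Rightarrow> bool) set \<Rightarrow> bool"
  where "meager_on S A \<longleftrightarrow> (\<exists>F. countable F \<and> (\<forall>N\<in>F. nowhere_dense_on S N) \<and> A \<subseteq> \<Union>F)"

lemma cyl_Nil [simp]: "cyl S [] = UNIV"
  by (simp add: cyl_def)

lemma cyl_nonempty: "cyl S l \<noteq> {}"
proof -
  have "(\<lambda>i. l ! i) \<in> cyl S l" by (simp add: cyl_def)
  then show ?thesis by blast
qed

lemma mem_cyl_map [simp]: "x \<in> cyl S (map x [0..<n])"
  by (simp add: cyl_def)

lemma cyl_cong: "x \<in> cyl S l \<Longrightarrow> (\<And>i. i \<in> S \<Longrightarrow> y i = x i) \<Longrightarrow> y \<in> cyl S l"
  by (simp add: cyl_def)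

text \<open>
  Of two cylinders with a common point, the one around that point determined by the longer initial
  segment lies in both; it can be named by an extension of either list.
\<close>

lemma cyl_refine:
  assumes "x \<in> cyl S l" "x \<in> cyl S l'"
  obtains r where "x \<in> cyl S (l @ r)" "cyl S (l @ r) \<subseteq> cyl S l'" "cyl S (l @ r) \<subseteq> cyl S l"
proof
  let ?r = "map x [length l..<length l'] "
  have nth: "(l @ ?r) ! i = (if i < length l then l ! i else x i)"
    if "i < length (l @ ?r)" for i
    using that by (auto simp: nth_append)
  show "x \<in> cyl S (l @ ?r)"
    unfolding cyl_def using assms nth by (auto simp: cyl_def)
  show "cyl S (l @ ?r) \<subseteq> cyl S l"
    by (auto simp: cyl_def nth_append)
  show "cyl S (l @ ?r) \<subseteq> cyl S l'"
  proof
    fix y assume y: "y \<in> cyl S (l @ ?r)"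
    have "y i = l' ! i" if "i < length l'" "i \<in> S" for i
    proof -
      have i: "i < length (l @ ?r)" using that by auto
      then have "y i = (l @ ?r) ! i" using y that by (simp add: cyl_def)
      also have "\<dots> = x i" using nth[OF i] assms(1) that by (auto simp: cyl_def)
      finally show ?thesis using assms(2) that by (simp add: cyl_def)
    qed
    then show "y \<in> cyl S l'" by (simp add: cyl_def)
  qed
qed

lemma restr_cyl: "restr (cyl S l) S = (\<Pi>\<^sub>E i\<in>S. if i < length l then {l ! i} else UNIV)"
proof (intro equalityI subsetI)
  fix x assume "x \<in> restr (cyl S l) S"
  then show "x \<in> (\<Pi>\<^sub>E i\<in>S. if i < length l then {l ! i} else UNIV)"
    by (auto simp: restr_def cyl_def)
next
  fix x assume x: "x \<in> (\<Pi>\<^sub>E i\<in>S. if i < length l then {l ! i} else UNIV)"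
  then have "x \<in> cyl S l" by (fastforce simp: cyl_def PiE_iff)
  moreover have "restrict x S = x" using x by (rule PiE_restrict)
  ultimately show "x \<in> restr (cyl S l) S" unfolding restr_def by (metis imageI)
qed

lemma openin_restr_cyl: "openin (two_pow S) (restr (cyl S l) S)"
proof -
  have "finite {i \<in> S. (if i < length l then {l ! i} else (UNIV::bool set)) \<noteq> UNIV}"
    by (rule finite_subset[of _ "{..<length l}"]) auto
  then show ?thesis
    unfolding two_pow_def restr_cyl by (auto simp: openin_PiE_gen)
qed

lemma restrict_mem_restr_cyl: "restrict x S \<in> restr (cyl S l) S \<longleftrightarrow> x \<in> cyl S l"
proof
  assume "restrict x S \<in> restr (cyl S l) S"
  then obtain y where y: "y \<in> cyl S l" "restrict x S = restrict y S"
    by (auto simp: restr_def)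
  then have "x i = y i" if "i \<in> S" for i
    using that by (metis restrict_apply')
  with y(1) show "x \<in> cyl S l" by (rule cyl_cong)
qed (auto simp: restr_def)

lemma two_pow_cyl_basis:
  assumes "openin (two_pow S) U" "x \<in> U"
  obtains n where "restr (cyl S (map x [0..<n])) S \<subseteq> U"
proof -
  have "\<forall>x\<in>U. \<exists>V. finite {i \<in> S. V i \<noteq> UNIV} \<and> x \<in> Pi\<^sub>E S V \<and> Pi\<^sub>E S V \<subseteq> U"
    using assms(1) by (simp add: two_pow_def openin_product_topology_alt)
  then obtain V where V: "finite {i \<in> S. V i \<noteq> UNIV}" "x \<in> Pi\<^sub>E S V" "Pi\<^sub>E S V \<subseteq> U"
    using assms(2) by blast
  obtain n where n: "{i \<in> S. V i \<noteq> UNIV} \<subseteq> {..<n}"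
    using finite_nat_bounded[OF V(1)] by blast
  have "restr (cyl S (map x [0..<n])) S \<subseteq> Pi\<^sub>E S V"
    unfolding restr_cyl
  proof (rule PiE_mono)
    fix i assume "i \<in> S"
    then show "(if i < length (map x [0..<n]) then {map x [0..<n] ! i} else UNIV) \<subseteq> V i"
      using n V(2) by (auto simp: PiE_iff)
  qed
  from order_trans[OF this V(3)] show thesis by (rule that)
qed

lemma restr_subset_topspace: "restr N S \<subseteq> topspace (two_pow S)"
  by (auto simp: topspace_two_pow restr_def)

text \<open>
  The cylinders restricted to \<open>S\<close> form a base of nonempty open sets of \<open>2\<^sup>S\<close>, and a nowhere dense set
  is one that misses a basic open subset of every basic open set.
\<close>

lemma nowhere_dense_in_restr: "nowhere_dense_in (two_pow S) (restr N S) \<longleftrightarrow> nowhere_dense_on S N"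
proof
  assume L: "nowhere_dense_in (two_pow S) (restr N S)"
  let ?K = "two_pow S closure_of restr N S"
  show "nowhere_dense_on S N"
    unfolding nowhere_dense_on_def
  proof
    fix l
    have "\<not> restr (cyl S l) S \<subseteq> ?K"
    proof
      assume "restr (cyl S l) S \<subseteq> ?K"
      then have "restr (cyl S l) S \<subseteq> two_pow S interior_of ?K"
        by (rule interior_of_maximal[OF _ openin_restr_cyl])
      then show False
        using L cyl_nonempty[of S l] by (auto simp: nowhere_dense_in_def restr_def)
    qed
    then obtain x where x: "x \<in> restr (cyl S l) S - ?K" by blast
    have op: "openin (two_pow S) (restr (cyl S l) S - ?K)"
      by (intro openin_diff openin_restr_cyl closedin_closure_of)
    obtain n where n: "restr (cyl S (map x [0..<n])) S \<subseteq> restr (cyl S l) S - ?K"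
      using two_pow_cyl_basis[OF op x] .
    have sub: "restrict y S \<in> restr (cyl S l) S - ?K" if "y \<in> cyl S (map x [0..<n])" for y
      using n that by (auto simp: restr_def)
    have "restr N S \<subseteq> ?K"
      by (intro closure_of_subset restr_subset_topspace)
    then have "restrict y S \<in> ?K" if "y \<in> N" for y
      using that by (auto simp: restr_def)
    then have "N \<inter> cyl S (map x [0..<n]) = {}"
      using sub by blast
    moreover have "cyl S (map x [0..<n]) \<subseteq> cyl S l"
      using sub by (auto simp: restrict_mem_restr_cyl)
    ultimately show "\<exists>l'. cyl S l' \<subseteq> cyl S l \<and> N \<inter> cyl S l' = {}"
      by blast
  qed
next
  assume R: "nowhere_dense_on S N"
  let ?K = "two_pow S closure_of restr N S"
  have "two_pow S interior_of ?K = {}"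
  proof (rule ccontr)
    assume "two_pow S interior_of ?K \<noteq> {}"
    then obtain x where x: "x \<in> two_pow S interior_of ?K" by blast
    obtain n where "restr (cyl S (map x [0..<n])) S \<subseteq> two_pow S interior_of ?K"
      using two_pow_cyl_basis[OF openin_interior_of x] .
    then have n: "restrict y S \<in> ?K" if "y \<in> cyl S (map x [0..<n])" for y
      using that interior_of_subset[of "two_pow S" ?K] by (auto simp: restr_def)
    obtain l where l: "cyl S l \<subseteq> cyl S (map x [0..<n])" "N \<inter> cyl S l = {}"
      using R unfolding nowhere_dense_on_def by blast
    obtain y where y: "y \<in> cyl S l" using cyl_nonempty by blast
    have "restrict y S \<in> ?K"
      using n l(1) y by blast
    moreover have "restrict y S \<in> restr (cyl S l) S"
      using y by (simp add: restrict_mem_restr_cyl)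
    ultimately have "restr N S \<inter> restr (cyl S l) S \<noteq> {}"
      using openin_restr_cyl[of S l] by (fastforce simp: in_closure_of)
    then obtain w where "w \<in> N" "restrict w S \<in> restr (cyl S l) S"
      by (auto simp: restr_def)
    then show False
      using l(2) by (auto simp: restrict_mem_restr_cyl)
  qed
  then show "nowhere_dense_in (two_pow S) (restr N S)"
    by (simp add: nowhere_dense_in_def restr_subset_topspace)
qed

lemma meager_in_restr: "meager_in (two_pow S) (restr X S) \<longleftrightarrow> meager_on S X"
proof
  assume "meager_in (two_pow S) (restr X S)"
  then obtain F where F: "countable F" "\<forall>N\<in>F. nowhere_dense_in (two_pow S) N"
      "restr X S = \<Union>F"
    by (auto simp: meager_in_def)
  \<comment> \<open>A nowhere dense subset of \<open>2\<^sup>S\<close> is pulled back along the restriction map.\<close>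
  define lift where "lift N = {x. restrict x S \<in> N}" for N :: "(nat \<Rightarrow> bool) set"
  have "nowhere_dense_on S (lift N)" if "N \<in> F" for N
  proof -
    have N: "nowhere_dense_in (two_pow S) N" using F(2) that by blast
    have "restr (lift N) S = N"
    proof (intro equalityI subsetI)
      fix x assume x: "x \<in> N"
      then have "x \<in> (\<Pi>\<^sub>E i\<in>S. UNIV)"
        using N by (auto simp: nowhere_dense_in_def topspace_two_pow)
      then have "restrict x S = x" by (rule PiE_restrict)
      with x show "x \<in> restr (lift N) S"
        unfolding restr_def by (intro image_eqI[of _ _ x]) (simp_all add: lift_def)
    qed (auto simp: restr_def lift_def)
    then show ?thesis
      using N nowhere_dense_in_restr[of S "lift N"] by simp
  qed
  moreover have "X \<subseteq> \<Union>(lift ` F)"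
  proof
    fix x assume "x \<in> X"
    then have "restrict x S \<in> restr X S" by (simp add: restr_def)
    then have "restrict x S \<in> \<Union>F" by (simp only: F(3))
    then show "x \<in> \<Union>(lift ` F)" by (simp add: lift_def)
  qed
  ultimately show "meager_on S X"
    unfolding meager_on_def using F(1) by (intro exI[of _ "lift ` F"] conjI) simp_all
next
  assume "meager_on S X"
  then obtain F where F: "countable F" "\<forall>N\<in>F. nowhere_dense_on S N" "X \<subseteq> \<Union>F"
    unfolding meager_on_def by blast
  let ?G = "(\<lambda>N. restr (N \<inter> X) S) ` F"
  have "nowhere_dense_in (two_pow S) (restr (N \<inter> X) S)" if "N \<in> F" for N
  proof -
    have "nowhere_dense_on S N" using F(2) that by blast
    then have "nowhere_dense_on S (N \<inter> X)" unfolding nowhere_dense_on_def by blast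
    then show ?thesis by (simp add: nowhere_dense_in_restr)
  qed
  moreover have "restr X S = \<Union>?G"
  proof -
    have "X = (\<Union>N\<in>F. N \<inter> X)" using F(3) by blast
    then have "restr X S = restr (\<Union>N\<in>F. N \<inter> X) S" by simp
    also have "\<dots> = \<Union>?G" unfolding restr_def by (rule image_UN)
    finally show ?thesis .
  qed
  ultimately show "meager_in (two_pow S) (restr X S)"
    unfolding meager_in_def using F(1) by (intro exI[of _ ?G] conjI) simp_all
qed

lemma meager_on_mono: "meager_on S B \<Longrightarrow> A \<subseteq> B \<Longrightarrow> meager_on S A"
  unfolding meager_on_def by (meson order_trans)

lemma meager_on_nowhere_dense: "nowhere_dense_on S N \<Longrightarrow> meager_on S N"
  unfolding meager_on_def by (intro exI[of _ "{N}"]) auto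

lemma meager_on_UN:
  assumes "countable I" "\<And>i. i \<in> I \<Longrightarrow> meager_on S (A i)"
  shows "meager_on S (\<Union>i\<in>I. A i)"
proof -
  have "\<forall>i\<in>I. \<exists>F. countable F \<and> (\<forall>N\<in>F. nowhere_dense_on S N) \<and> A i \<subseteq> \<Union>F"
    using assms(2) by (simp add: meager_on_def)
  from bchoice[OF this] obtain F where
    "\<forall>i\<in>I. countable (F i) \<and> (\<forall>N\<in>F i. nowhere_dense_on S N) \<and> A i \<subseteq> \<Union>(F i)" ..
  then show ?thesis
    unfolding meager_on_def using assms(1) by (intro exI[of _ "\<Union>i\<in>I. F i"]) (auto, blast)
qed

lemma meager_on_Un: "meager_on S A \<Longrightarrow> meager_on S B \<Longrightarrow> meager_on S (A \<union> B)"
  using meager_on_UN[of "{A, B}" S "\<lambda>x. x"] by auto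

section \<open>Comeager sets project onto full powers\<close>

text \<open>
  One block \<open>e\<close> serves all initial segments of length \<open>k\<close> because there are only finitely many of
  them: treat them in turn, each time lengthening the block obtained so far.
\<close>

lemma nowhere_dense_on_uniform_escape:
  assumes "nowhere_dense_on S N"
  obtains e where "\<And>q. length q = k \<Longrightarrow> N \<inter> cyl S (q @ e) = {}"
proof -
  have "\<exists>e. \<forall>q\<in>Q. N \<inter> cyl S (q @ e) = {}" if "finite Q" for Q
    using that
  proof induction
    case empty
    show ?case by simp
  next
    case (insert q Q)
    then obtain e where e: "\<forall>q\<in>Q. N \<inter> cyl S (q @ e) = {}" by blast
    obtain l where l: "cyl S l \<subseteq> cyl S (q @ e)" "N \<inter> cyl S l = {}"
      using assms unfolding nowhere_dense_on_def by blast
    obtain x where x: "x \<in> cyl S l" using cyl_nonempty by blast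
    obtain r where r: "cyl S ((q @ e) @ r) \<subseteq> cyl S l"
      using cyl_refine[OF subsetD[OF l(1) x] x] .
    have "cyl S (q' @ e @ r) \<subseteq> cyl S (q' @ e)" for q'
      by (fastforce simp: cyl_def nth_append)
    then show ?case
      using e l(2) r by (intro exI[of _ "e @ r"]) auto
  qed
  moreover have "finite {q :: bool list. length q = k}"
    using finite_lists_length_eq[of "UNIV :: bool set" k] by simp
  ultimately show thesis using that by blast
qed

text \<open>
  The last conjunct says that \<open>x\<restriction>S \<notin> M\<restriction>S\<close>.  The points \<open>\<tau> 0 < \<tau> 1 < \<dots>\<close> of \<open>T\<close> are spaced so
  that the block following \<open>\<tau> n\<close>, which escapes the \<open>n\<close>-th nowhere dense set for all initial segments
  up to and including \<open>\<tau> n\<close>, ends before \<open>\<tau> (Suc n)\<close>.  Thus an arbitrary \<open>t\<close> can be prescribed on \<open>T\<close>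
  and the blocks filled in without conflict.
\<close>

lemma comeager_contains_cube:
  assumes "infinite S" "meager_on S M"
  shows "\<exists>T. infinite T \<and> T \<subseteq> S \<and>
    (\<forall>t. \<exists>x\<in>cyl S l. (\<forall>i\<in>T. x i = t i) \<and> (\<forall>y\<in>M. \<exists>i\<in>S. y i \<noteq> x i))"
proof -
  obtain F where F: "countable F" "\<And>N. N \<in> F \<Longrightarrow> nowhere_dense_on S N" "M \<subseteq> \<Union>F"
    using assms(2) unfolding meager_on_def by blast
  \<comment> \<open>Adding the empty set makes the family nonempty, so that a sequence can enumerate it.\<close>
  have "nowhere_dense_on S {}" by (auto simp: nowhere_dense_on_def)
  define N where "N = from_nat_into (insert {} F)"
  have N: "nowhere_dense_on S (N n)" for n
    using from_nat_into[of "insert {} F" n] F(2) \<open>nowhere_dense_on S {}\<close> by (auto simp: N_def)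
  have "range N = insert {} F"
    unfolding N_def using F(1) by (intro range_from_nat_into) auto
  then have M: "M \<subseteq> (\<Union>n. N n)" using F(3) by auto
  have "\<forall>n k. \<exists>e. \<forall>q. length q = k \<longrightarrow> N n \<inter> cyl S (q @ e) = {}"
    using nowhere_dense_on_uniform_escape[OF N] by metis
  then obtain e where e: "\<And>n k q. length q = k \<Longrightarrow> N n \<inter> cyl S (q @ e n k) = {}"
    by metis
  have ex: "\<exists>j. j \<in> S \<and> m < j" for m
    using assms(1) by (auto simp: infinite_nat_iff_unbounded)
  have "\<exists>\<tau>. \<forall>n. (\<tau> n \<in> S \<and> length l \<le> \<tau> n) \<and> \<tau> n + length (e n (Suc (\<tau> n))) < \<tau> (Suc n)"
  proof (rule dependent_nat_choice)
    show "\<exists>j. j \<in> S \<and> length l \<le> j" using ex less_imp_le by blast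
    fix j n assume "j \<in> S \<and> length l \<le> j"
    then show "\<exists>j'. (j' \<in> S \<and> length l \<le> j') \<and> j + length (e n (Suc j)) < j'"
      using ex[of "j + length (e n (Suc j))"] by auto
  qed
  then obtain \<tau> where \<tau>: "\<And>n. \<tau> n \<in> S \<and> length l \<le> \<tau> n"
    and step: "\<And>n. \<tau> n + length (e n (Suc (\<tau> n))) < \<tau> (Suc n)"
    by blast
  define E where "E n = e n (Suc (\<tau> n))" for n
  have step: "\<tau> n + length (E n) < \<tau> (Suc n)" for n using step by (simp add: E_def)
  have mono: "strict_mono \<tau>"
    using step by (intro strict_monoI_Suc) (meson add_lessD1)
  have gap: "\<tau> n + length (E n) < \<tau> m" if "n < m" for n m
    using step[of n] strict_mono_mono[OF mono, THEN monoD, of "Suc n" m] that by linarith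
  show ?thesis
  proof (rule exI[of _ "range \<tau>"], intro conjI allI)
    show "infinite (range \<tau>)"
      using strict_mono_imp_inj_on[OF mono] range_inj_infinite by blast
    show "range \<tau> \<subseteq> S" using \<tau> by blast
    fix t :: "nat \<Rightarrow> bool"
    \<comment> \<open>At positions in no block the existential statement is false, which is an arbitrary value.\<close>
    define x where "x i = (if i < length l then l ! i else if i \<in> range \<tau> then t i
        else \<exists>n. \<tau> n < i \<and> i \<le> \<tau> n + length (E n) \<and> E n ! (i - Suc (\<tau> n)))" for i
    have "x \<in> cyl S l" by (simp add: cyl_def x_def)
    moreover have "\<forall>i\<in>range \<tau>. x i = t i"
      using \<tau> by (auto simp: x_def leD)
    moreover have "\<exists>i\<in>S. y i \<noteq> x i" if "y \<in> M" for y
    proof (rule ccontr)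
      assume "\<not> (\<exists>i\<in>S. y i \<noteq> x i)"
      then have eq: "y i = x i" if "i \<in> S" for i using that by blast
      obtain n where n: "y \<in> N n" using \<open>y \<in> M\<close> M by blast
      have xE: "x (Suc (\<tau> n) + j) = E n ! j" if "j < length (E n)" for j
      proof -
        let ?i = "Suc (\<tau> n) + j"
        have uniq: "m = n" if m: "\<tau> m < ?i" "?i \<le> \<tau> m + length (E m)" for m
        proof (rule linorder_cases[of m n])
          assume "m < n" then show ?thesis using gap[of m n] m by simp
        next
          assume "n < m" then show ?thesis using gap[of n m] m \<open>j < length (E n)\<close> by simp
        qed
        have "?i \<notin> range \<tau>"
        proof
          assume "?i \<in> range \<tau>"
          then obtain m where m: "?i = \<tau> m" by blast
          have "\<tau> n < \<tau> m" using m by linarith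
          then have "n < m" using mono strict_mono_less by blast
          then show False using gap[of n m] m that by linarith
        qed
        moreover have "\<not> ?i < length l" using \<tau>[of n] by simp
        ultimately have "x ?i \<longleftrightarrow> (\<exists>m. \<tau> m < ?i \<and> ?i \<le> \<tau> m + length (E m) \<and> E m ! (?i - Suc (\<tau> m)))"
          by (simp only: x_def if_False)
        also have "\<dots> \<longleftrightarrow> E n ! j"
        proof
          assume "\<exists>m. \<tau> m < ?i \<and> ?i \<le> \<tau> m + length (E m) \<and> E m ! (?i - Suc (\<tau> m))"
          then show "E n ! j" using uniq by (metis add_diff_cancel_left')
        next
          assume "E n ! j"
          then show "\<exists>m. \<tau> m < ?i \<and> ?i \<le> \<tau> m + length (E m) \<and> E m ! (?i - Suc (\<tau> m))"
            using that by (intro exI[of _ n]) simp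
        qed
        finally show ?thesis .
      qed
      let ?q = "map x [0..<Suc (\<tau> n)]"
      have "x \<in> cyl S (?q @ E n)"
        unfolding cyl_def
      proof safe
        fix i assume i: "i < length (?q @ E n)"
        have "x i = (?q @ E n) ! i"
        proof (cases "i < Suc (\<tau> n)")
          case True
          then have "?q ! i = x i" by (metis add_0 diff_zero nth_map_upt)
          with True show ?thesis by (simp add: nth_append del: upt_Suc)
        next
          case False
          then show ?thesis using i xE[of "i - Suc (\<tau> n)"]
            by (simp add: nth_append del: upt_Suc)
        qed
        then show "x i \<Longrightarrow> (?q @ E n) ! i" "(?q @ E n) ! i \<Longrightarrow> x i" by simp_all
      qed
      then have "y \<in> cyl S (?q @ E n)" using eq cyl_cong by blast
      then show False using e[of ?q "Suc (\<tau> n)" n] n by (auto simp: E_def)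
    qed
    ultimately show "\<exists>x\<in>cyl S l. (\<forall>i\<in>range \<tau>. x i = t i) \<and> (\<forall>y\<in>M. \<exists>i\<in>S. y i \<noteq> x i)"
      by blast
  qed
qed

section \<open>Borel sets are projections of closed sets\<close>

text \<open>
  Closedness in \<open>2\<^sup>\<omega> \<times> \<omega>\<^sup>\<omega>\<close>: a pair belongs to \<open>C\<close> as soon as all its finite initial parts are
  approximated by members of \<open>C\<close>.
\<close>

definition seq_closed :: "((nat \<Rightarrow> bool) \<Rightarrow> (nat \<Rightarrow> nat) \<Rightarrow> bool) \<Rightarrow> bool"
  where "seq_closed C \<longleftrightarrow>
    (\<forall>x z. (\<forall>n. \<exists>x' z'. C x' z' \<and> (\<forall>i<n. x' i = x i) \<and> (\<forall>i<n. z' i = z i)) \<longrightarrow> C x z)"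

definition analytic :: "(nat \<Rightarrow> bool) set \<Rightarrow> bool"
  where "analytic X \<longleftrightarrow> (\<exists>C. seq_closed C \<and> X = {x. \<exists>z. C x z})"

lemma seq_closedD:
  "seq_closed C \<Longrightarrow> (\<And>n. \<exists>x' z'. C x' z' \<and> (\<forall>i<n. x' i = x i) \<and> (\<forall>i<n. z' i = z i)) \<Longrightarrow> C x z"
  unfolding seq_closed_def by blast

text \<open>
  A single witness \<open>z\<close> codes a sequence of witnesses via \<^const>\<open>prod_encode\<close>.  The coded set is closed
  since finitely many values of the \<open>i\<close>-th witness depend on finitely many values of \<open>z\<close>.
\<close>

lemma analytic_INT:
  fixes A :: "nat \<Rightarrow> (nat \<Rightarrow> bool) set"
  assumes "\<And>i. analytic (A i)"
  shows "analytic (\<Inter>i. A i)"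
proof -
  obtain C where C: "\<And>i. seq_closed (C i)" "\<And>i. A i = {x. \<exists>z. C i x z}"
    using assms unfolding analytic_def by metis
  define D where "D x z \<longleftrightarrow> (\<forall>i. C i x (\<lambda>k. z (prod_encode (i, k))))" for x z
  have "seq_closed D"
    unfolding seq_closed_def
  proof (intro allI impI)
    fix x z assume H: "\<forall>n. \<exists>x' z'. D x' z' \<and> (\<forall>i<n. x' i = x i) \<and> (\<forall>i<n. z' i = z i)"
    have "C i x (\<lambda>k. z (prod_encode (i, k)))" for i
    proof (rule seq_closedD[OF C(1)[of i]])
      fix n
      obtain m where m: "(\<lambda>k. prod_encode (i, k)) ` {..<n} \<subseteq> {..<m}"
        using finite_nat_bounded[of "(\<lambda>k. prod_encode (i, k)) ` {..<n}"] by blast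
      obtain x' z' where D: "D x' z'" "\<forall>j<max m n. x' j = x j" "\<forall>j<max m n. z' j = z j"
        using H[rule_format, of "max m n"] by blast
      then show "\<exists>x' z'. C i x' z' \<and> (\<forall>i<n. x' i = x i) \<and> (\<forall>k<n. z' k = z (prod_encode (i, k)))"
        using m by (intro exI[of _ x'] exI[of _ "\<lambda>k. z' (prod_encode (i, k))"]) (auto simp: D_def)
    qed
    then show "D x z" unfolding D_def by blast
  qed
  moreover have "(\<Inter>i. A i) = {x. \<exists>z. D x z}"
  proof (intro equalityI subsetI)
    fix x assume "x \<in> (\<Inter>i. A i)"
    then have "\<forall>i. \<exists>z. C i x z" using C(2) by blast
    from choice[OF this] obtain z where "\<forall>i. C i x (z i)" ..
    then have "D x (\<lambda>j. case prod_decode j of (i, k) \<Rightarrow> z i k)" by (simp add: D_def)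
    then show "x \<in> {x. \<exists>z. D x z}" by blast
  next
    fix x assume "x \<in> {x. \<exists>z. D x z}"
    then show "x \<in> (\<Inter>i. A i)" using C(2) by (auto simp: D_def)
  qed
  ultimately show ?thesis unfolding analytic_def by blast
qed

text \<open>
  The value \<open>z 0\<close> names the set that contains \<open>x\<close>, and the remaining values form the witness.
\<close>

lemma analytic_UN:
  fixes A :: "nat \<Rightarrow> (nat \<Rightarrow> bool) set"
  assumes "\<And>i. analytic (A i)"
  shows "analytic (\<Union>i. A i)"
proof -
  obtain C where C: "\<And>i. seq_closed (C i)" "\<And>i. A i = {x. \<exists>z. C i x z}"
    using assms unfolding analytic_def by metis
  define D where "D x z \<longleftrightarrow> C (z 0) x (\<lambda>k. z (Suc k))" for x z
  have "seq_closed D"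
    unfolding seq_closed_def
  proof (intro allI impI)
    fix x z assume H: "\<forall>n. \<exists>x' z'. D x' z' \<and> (\<forall>i<n. x' i = x i) \<and> (\<forall>i<n. z' i = z i)"
    have "C (z 0) x (\<lambda>k. z (Suc k))"
    proof (rule seq_closedD[OF C(1)[of "z 0"]])
      fix n
      obtain x' z' where "D x' z'" "\<forall>j<Suc n. x' j = x j" "\<forall>j<Suc n. z' j = z j"
        using H[rule_format, of "Suc n"] by blast
      then show "\<exists>x' z'. C (z 0) x' z' \<and> (\<forall>i<n. x' i = x i) \<and> (\<forall>k<n. z' k = z (Suc k))"
        by (intro exI[of _ x'] exI[of _ "\<lambda>k. z' (Suc k)"]) (auto simp: D_def)
    qed
    then show "D x z" unfolding D_def by blast
  qed
  moreover have "(\<Union>i. A i) = {x. \<exists>z. D x z}"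
  proof (intro equalityI subsetI)
    fix x assume "x \<in> (\<Union>i. A i)"
    then obtain i z where "C i x z" using C(2) by blast
    then have "D x (case_nat i z)" by (simp add: D_def)
    then show "x \<in> {x. \<exists>z. D x z}" by blast
  next
    fix x assume "x \<in> {x. \<exists>z. D x z}"
    then show "x \<in> (\<Union>i. A i)" using C(2) by (auto simp: D_def)
  qed
  ultimately show ?thesis unfolding analytic_def by blast
qed

lemma analytic_finitely_determined:
  assumes "\<And>x y. x \<in> A \<Longrightarrow> (\<forall>i<n. y i = x i) \<Longrightarrow> y \<in> A"
  shows "analytic A"
  unfolding analytic_def
proof (intro exI conjI)
  show "seq_closed (\<lambda>x z. x \<in> A)"
    unfolding seq_closed_def
  proof (intro allI impI)
    fix x z assume "\<forall>n. \<exists>x' z'. x' \<in> A \<and> (\<forall>i<n. x' i = x i) \<and> (\<forall>i<n. z' i = z i)"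
    then obtain x' where "x' \<in> A" "\<forall>i<n. x' i = x i" by meson
    then show "x \<in> A" using assms[of x' x] by simp
  qed
qed simp

text \<open>
  An open set is the union of the sets \<open>A n\<close> of those points whose cylinder of length \<open>n\<close> it contains;
  membership in \<open>A n\<close> depends on \<open>n\<close> coordinates only, so \<open>A n\<close> and its complement are closed.
\<close>

lemma open_analytic:
  assumes "open U"
  shows "analytic U" "analytic (- U)"
proof -
  define A where "A n = {x. \<forall>y. (\<forall>i<n. y i = x i) \<longrightarrow> y \<in> U}" for n
  have A: "y \<in> A n" if "x \<in> A n" "\<forall>i<n. y i = x i" for x y n
    using that unfolding A_def by auto
  have U: "U = (\<Union>n. A n)"
  proof (intro equalityI subsetI)
    fix x assume "x \<in> U"
    then obtain n where n: "restr (cyl UNIV (map x [0..<n])) UNIV \<subseteq> U"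
      using two_pow_cyl_basis[of UNIV U x] assms by (auto simp: two_pow_UNIV)
    have "restr B UNIV = B" for B by (simp add: restr_def restrict_def)
    then have "x \<in> A n" using n by (auto simp: A_def cyl_def)
    then show "x \<in> (\<Union>n. A n)" by blast
  qed (auto simp: A_def)
  have "analytic (A n)" for n
    by (rule analytic_finitely_determined[where n = n]) (rule A)
  then have "analytic (\<Union>n. A n)" by (rule analytic_UN)
  then show "analytic U" by (simp only: U[symmetric])
  have "analytic (- A n)" for n
  proof (rule analytic_finitely_determined[where n = n])
    fix x y assume "x \<in> - A n" "\<forall>i<n. y i = x i"
    then show "y \<in> - A n" using A[of y n x] by auto
  qed
  then have "analytic (\<Inter>n. - A n)" by (rule analytic_INT)
  then show "analytic (- U)" by (simp only: U Compl_UN)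
qed

text \<open>
  Analytic sets need not have analytic complements, so the induction over the Borel sets carries
  analyticity of the set and of its complement together.
\<close>

lemma borel_analytic:
  fixes X :: "(nat \<Rightarrow> bool) set"
  assumes "X \<in> sets borel"
  shows "analytic X"
proof -
  have "X \<in> sigma_sets UNIV {U. open U}"
    using assms by (simp add: borel_def)
  then have "analytic X \<and> analytic (- X)"
  proof induction
    case (Basic U)
    then show ?case using open_analytic by blast
  next
    case Empty
    then show ?case using open_analytic[of "{}"] by simp
  next
    case (Compl A)
    then show ?case by (simp add: Compl_eq_Diff_UNIV[symmetric])
  next
    case (Union A)
    then show ?case using analytic_UN[of A] analytic_INT[of "\<lambda>i. - A i"] by (simp add: Compl_UN)
  qed
  then show ?thesis ..
qed

section \<open>A nonmeager analytic set is comeager in a cylinder\<close>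

definition heavy :: "nat set \<Rightarrow> (nat \<Rightarrow> bool) set \<Rightarrow> (nat \<Rightarrow> bool) set"
  where "heavy S A = {x. \<exists>l. x \<in> cyl S l \<and> (\<forall>l'. cyl S l' \<subseteq> cyl S l \<longrightarrow> \<not> meager_on S (A \<inter> cyl S l'))}"

text \<open>
  The cylinders in which \<open>A\<close> is meager are countably many and so contribute a meager part.  What
  remains, \<open>R\<close>, is nowhere dense: a cylinder without a subcylinder of that kind lies in
  \<open>heavy S A\<close>.
\<close>

lemma meager_on_Diff_heavy: "meager_on S (A - heavy S A)"
proof -
  define L where "L = {l. meager_on S (A \<inter> cyl S l)}"
  define R where "R = - heavy S A - (\<Union>l\<in>L. cyl S l)"
  have "meager_on S (\<Union>l\<in>L. A \<inter> cyl S l)"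
    by (rule meager_on_UN) (auto simp: L_def)
  moreover have "nowhere_dense_on S R"
    unfolding nowhere_dense_on_def
  proof
    fix l
    show "\<exists>l'. cyl S l' \<subseteq> cyl S l \<and> R \<inter> cyl S l' = {}"
    proof (cases "\<exists>l'. cyl S l' \<subseteq> cyl S l \<and> l' \<in> L")
      case True
      then show ?thesis by (auto simp: R_def)
    next
      case False
      then have "cyl S l \<subseteq> heavy S A" by (auto simp: heavy_def L_def)
      then show ?thesis by (auto simp: R_def)
    qed
  qed
  ultimately have "meager_on S ((\<Union>l\<in>L. A \<inter> cyl S l) \<union> R)"
    by (rule meager_on_Un[OF _ meager_on_nowhere_dense])
  then show ?thesis by (rule meager_on_mono) (auto simp: R_def)
qed

lemma heavy_cyl:
  assumes "x \<in> heavy S A" "x \<in> cyl S l"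
  obtains l' where "x \<in> cyl S l'" "cyl S l' \<subseteq> cyl S l" "cyl S l' \<subseteq> heavy S A"
    "\<not> meager_on S (A \<inter> cyl S l')"
proof -
  obtain k where k: "x \<in> cyl S k" "\<forall>l'. cyl S l' \<subseteq> cyl S k \<longrightarrow> \<not> meager_on S (A \<inter> cyl S l')"
    using assms(1) by (auto simp: heavy_def)
  obtain r where r: "x \<in> cyl S (l @ r)" "cyl S (l @ r) \<subseteq> cyl S k" "cyl S (l @ r) \<subseteq> cyl S l"
    using cyl_refine[OF assms(2) k(1)] .
  moreover have "cyl S (l @ r) \<subseteq> heavy S A"
    using k(2) r(2) unfolding heavy_def by blast
  ultimately show thesis using that k(2) by blast
qed

text \<open>
  If a cylinder inside \<open>heavy S (\<Union>n. A n)\<close> met no \<open>heavy S (A n)\<close>, then each \<open>A n\<close> would be meager in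
  it, by \<open>meager_on_Diff_heavy\<close>, and so would their union.
\<close>

lemma nowhere_dense_on_heavy_Diff:
  fixes A :: "nat \<Rightarrow> (nat \<Rightarrow> bool) set"
  shows "nowhere_dense_on S (heavy S (\<Union>n. A n) - (\<Union>n. heavy S (A n)))"
  unfolding nowhere_dense_on_def
proof
  fix l
  let ?H = "heavy S (\<Union>n. A n)" and ?W = "\<Union>n. heavy S (A n)"
  consider "cyl S l \<inter> ?H = {}" | x n where "x \<in> cyl S l" "x \<in> heavy S (A n)"
    | x where "x \<in> cyl S l" "x \<in> ?H" "cyl S l \<inter> ?W = {}"
    by blast
  then show "\<exists>l'. cyl S l' \<subseteq> cyl S l \<and> (?H - ?W) \<inter> cyl S l' = {}"
  proof cases
    case 1
    then show ?thesis by blast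
  next
    case (2 x n)
    then obtain l' where "cyl S l' \<subseteq> cyl S l" "cyl S l' \<subseteq> heavy S (A n)"
      using heavy_cyl by metis
    then show ?thesis by blast
  next
    case (3 x)
    obtain l' where l': "cyl S l' \<subseteq> cyl S l" "\<not> meager_on S ((\<Union>n. A n) \<inter> cyl S l')"
      using heavy_cyl[OF 3(2,1)] .
    have "meager_on S (\<Union>n. A n - heavy S (A n))"
      by (intro meager_on_UN meager_on_Diff_heavy) simp
    then have "meager_on S ((\<Union>n. A n) \<inter> cyl S l')"
      by (rule meager_on_mono) (use l'(1) 3(3) in blast)
    with l'(2) show ?thesis by contradiction
  qed
qed

lemma infinite_branch:
  assumes "P []" "\<And>s. P s \<Longrightarrow> \<exists>a. P (s @ [a])"
  obtains z where "\<And>n. P (map z [0..<n])"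
proof -
  have "\<exists>f. \<forall>n. (P (f n) \<and> length (f n) = n) \<and> (\<exists>a. f (Suc n) = f n @ [a])"
  proof (rule dependent_nat_choice)
    show "\<exists>s. P s \<and> length s = 0" using assms(1) by simp
    fix s n assume "P s \<and> length s = n"
    then show "\<exists>s'. (P s' \<and> length s' = Suc n) \<and> (\<exists>a. s' = s @ [a])"
      using assms(2)[of s] by auto
  qed
  then obtain f where f: "\<And>n. P (f n) \<and> length (f n) = n" "\<And>n. \<exists>a. f (Suc n) = f n @ [a]"
    by blast
  have eq: "f n = map (\<lambda>i. last (f (Suc i))) [0..<n]" for n
  proof (induction n)
    case 0
    then show ?case using f(1)[of 0] by simp
  next
    case (Suc n)
    then show ?case using f(2)[of n] by auto
  qed
  show thesis
  proof
    show "P (map (\<lambda>i. last (f (Suc i))) [0..<n])" for n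
      using f(1) eq by metis
  qed
qed

text \<open>
  Sequential compactness of the Cantor space, by Koenig's argument: build the cluster point bit by
  bit, keeping infinitely many terms of the sequence compatible with it.
\<close>

lemma cantor_cluster_point:
  fixes f :: "nat \<Rightarrow> nat \<Rightarrow> bool"
  shows "\<exists>y. \<forall>m. \<exists>n\<ge>m. \<forall>i<m. f n i = y i"
proof -
  define P where "P s \<longleftrightarrow> infinite {n. map (f n) [0..<length s] = s}" for s
  have "\<exists>a. P (s @ [a])" if "P s" for s
  proof (rule ccontr)
    assume "\<not> (\<exists>a. P (s @ [a]))"
    then have "finite (\<Union>a. {n. map (f n) [0..<length (s @ [a])] = s @ [a]})"
      by (simp add: P_def)
    moreover have "{n. map (f n) [0..<length s] = s} \<subseteq>
        (\<Union>a. {n. map (f n) [0..<length (s @ [a])] = s @ [a]})"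
      by auto
    ultimately show False using that finite_subset unfolding P_def by blast
  qed
  moreover have "P []" by (simp add: P_def)
  ultimately obtain y where y: "\<And>n. P (map y [0..<n])"
    using infinite_branch by metis
  show ?thesis
  proof (rule exI[of _ y], rule allI)
    fix m
    have "infinite {n. map (f n) [0..<m] = map y [0..<m]}"
      using y[of m] by (simp add: P_def)
    then obtain n where "n \<ge> m" "map (f n) [0..<m] = map y [0..<m]"
      by (auto simp: infinite_nat_iff_unbounded_le)
    then show "\<exists>n\<ge>m. \<forall>i<m. f n i = y i" by auto
  qed
qed

text \<open>
  The set in the conclusion consists of the points \<open>x\<close> of the cylinder with \<open>x\<restriction>S \<notin> X\<restriction>S\<close>.  Apart from
  the meager set \<open>M\<close>, every point of the cylinder has a branch \<open>z\<close> along which it stays heavy.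
  Heaviness at each level supplies a point of \<open>C\<close> that agrees up to that level with
  \<open>x\<close> on \<open>S\<close> and with \<open>z\<close>.
  The coordinates outside \<open>S\<close> are uncontrolled, and compactness takes care of them.
\<close>

lemma analytic_comeager_in_cyl:
  assumes "analytic X" "\<not> meager_on S X"
  obtains l where "meager_on S {x \<in> cyl S l. \<not> (\<exists>y\<in>X. \<forall>i\<in>S. y i = x i)}"
proof -
  obtain C where C: "seq_closed C" "X = {x. \<exists>z. C x z}"
    using assms(1) unfolding analytic_def by blast
  define A where "A s = {x. \<exists>z. C x z \<and> map z [0..<length s] = s}" for s
  have AUN: "A s = (\<Union>n. A (s @ [n]))" for s
    by (auto simp: A_def)
  have "A [] = X" by (auto simp: A_def C(2))
  have "heavy S X \<noteq> {}"
    using meager_on_Diff_heavy[of S X] assms(2) by auto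
  then obtain x where "x \<in> heavy S X" by blast
  then obtain l where l: "cyl S l \<subseteq> heavy S X"
    using heavy_cyl[of x S X "[]"] by (metis UNIV_I cyl_Nil)
  define M where "M = (\<Union>s. heavy S (A s) - (\<Union>n. heavy S (A (s @ [n]))))"
  have "nowhere_dense_on S (heavy S (A s) - (\<Union>n. heavy S (A (s @ [n]))))" for s
    using nowhere_dense_on_heavy_Diff[of S "\<lambda>n. A (s @ [n])"] AUN[of s] by simp
  then have M: "meager_on S M"
    unfolding M_def by (intro meager_on_UN meager_on_nowhere_dense) auto
  have "\<exists>y\<in>X. \<forall>i\<in>S. y i = x i" if x: "x \<in> cyl S l" "x \<notin> M" for x
  proof -
    have "x \<in> heavy S (A [])" using x(1) l \<open>A [] = X\<close> by auto
    moreover have "\<exists>n. x \<in> heavy S (A (s @ [n]))" if "x \<in> heavy S (A s)" for s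
      using that x(2) by (auto simp: M_def)
    ultimately obtain z where z: "\<And>n. x \<in> heavy S (A (map z [0..<n]))"
      using infinite_branch[of "\<lambda>s. x \<in> heavy S (A s)"] by metis
    have "\<exists>y w. C y w \<and> (\<forall>i<n. w i = z i) \<and> (\<forall>i<n. i \<in> S \<longrightarrow> y i = x i)" for n
    proof -
      obtain l' where l': "cyl S l' \<subseteq> cyl S (map x [0..<n])"
          "\<not> meager_on S (A (map z [0..<n]) \<inter> cyl S l')"
        using heavy_cyl[OF z mem_cyl_map] .
      have "meager_on S {}" by (auto simp: meager_on_def)
      with l'(2) have "A (map z [0..<n]) \<inter> cyl S l' \<noteq> {}" by metis
      with l'(1) obtain y where "y \<in> A (map z [0..<n])" "y \<in> cyl S (map x [0..<n])" by blast
      moreover from this(1) obtain w where "C y w" "map w [0..<n] = map z [0..<n]"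
        by (auto simp: A_def)
      ultimately show ?thesis
        by (intro exI[of _ y] exI[of _ w]) (simp add: cyl_def map_eq_conv)
    qed
    then obtain f w where fw: "\<And>n. C (f n) (w n)" "\<And>n i. i < n \<Longrightarrow> w n i = z i"
        "\<And>n i. i < n \<Longrightarrow> i \<in> S \<Longrightarrow> f n i = x i"
      by metis
    obtain y where y: "\<And>m. \<exists>n\<ge>m. \<forall>i<m. f n i = y i"
      using cantor_cluster_point[of f] by blast
    have "C y z"
    proof (rule seq_closedD[OF C(1)])
      fix m
      obtain n where "n \<ge> m" "\<forall>i<m. f n i = y i" using y by blast
      then show "\<exists>x' z'. C x' z' \<and> (\<forall>i<m. x' i = y i) \<and> (\<forall>i<m. z' i = z i)"
        using fw(1,2) by (intro exI[of _ "f n"] exI[of _ "w n"]) auto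
    qed
    moreover have "y i = x i" if "i \<in> S" for i
      using y[of "Suc i"] fw(3) that by (metis Suc_le_eq lessI)
    ultimately show ?thesis using C(2) by blast
  qed
  then have "{x \<in> cyl S l. \<not> (\<exists>y\<in>X. \<forall>i\<in>S. y i = x i)} \<subseteq> M" by blast
  then show thesis using that meager_on_mono[OF M] by blast
qed

section \<open>The equality of the two families\<close>

lemma restr_eq_topspace_iff:
  "restr X T = topspace (two_pow T) \<longleftrightarrow> (\<forall>t. \<exists>y\<in>X. \<forall>i\<in>T. y i = t i)"
proof
  assume L: "restr X T = topspace (two_pow T)"
  show "\<forall>t. \<exists>y\<in>X. \<forall>i\<in>T. y i = t i"
  proof
    fix t
    have "restrict t T \<in> restr X T" using L by (simp add: topspace_two_pow)
    then obtain y where y: "y \<in> X" "restrict t T = restrict y T" by (auto simp: restr_def)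
    have "y i = t i" if "i \<in> T" for i
      using fun_cong[OF y(2), of i] that by simp
    with y(1) show "\<exists>y\<in>X. \<forall>i\<in>T. y i = t i" by blast
  qed
next
  assume R: "\<forall>t. \<exists>y\<in>X. \<forall>i\<in>T. y i = t i"
  have "t \<in> restr X T" if "t \<in> topspace (two_pow T)" for t
  proof -
    obtain y where y: "y \<in> X" "\<forall>i\<in>T. y i = t i" using R by blast
    have "t = restrict t T"
      using that PiE_restrict[of t T "\<lambda>_. UNIV"] by (simp add: topspace_two_pow)
    also have "\<dots> = restrict y T"
      by (rule restrict_ext) (simp add: y(2))
    finally show ?thesis using y(1) by (simp add: restr_def)
  qed
  then show "restr X T = topspace (two_pow T)" using restr_subset_topspace by blast
qed

text \<open>
  If \<open>X\<restriction>S\<close> is meager, its complement projects onto some \<open>2\<^sup>T\<close> and in particular is nonempty.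
\<close>

lemma EM_subset_P2: "EM \<subseteq> P2"
proof
  fix X assume X: "X \<in> EM"
  have "restr X S \<noteq> topspace (two_pow S)" if "infinite S" for S
  proof
    assume full: "restr X S = topspace (two_pow S)"
    have "meager_on S X" using X that by (simp add: EM_def meager_in_restr)
    then obtain x where "\<forall>y\<in>X. \<exists>i\<in>S. y i \<noteq> x i"
      using comeager_contains_cube[OF \<open>infinite S\<close>, of X "[]"] by blast
    moreover obtain y where "y \<in> X" "\<forall>i\<in>S. y i = x i"
      using full[unfolded restr_eq_topspace_iff, rule_format, of x] by (rule bexE)
    ultimately show False by blast
  qed
  then show "X \<in> P2" by (simp add: P2_def)
qed

lemma analytic_P2_imp_EM:
  assumes "analytic X" "X \<in> P2"
  shows "X \<in> EM"
proof -
  have "meager_on S X" if "infinite S" for S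
  proof (rule ccontr)
    assume nonmeager: "\<not> meager_on S X"
    obtain l where M: "meager_on S {x \<in> cyl S l. \<not> (\<exists>y\<in>X. \<forall>i\<in>S. y i = x i)}" (is "meager_on S ?M")
      using analytic_comeager_in_cyl[OF assms(1) nonmeager] .
    obtain T where "infinite T \<and> T \<subseteq> S \<and>
        (\<forall>t. \<exists>x\<in>cyl S l. (\<forall>i\<in>T. x i = t i) \<and> (\<forall>y\<in>?M. \<exists>i\<in>S. y i \<noteq> x i))"
      using comeager_contains_cube[OF \<open>infinite S\<close> M, of l] ..
    then have T: "infinite T" "T \<subseteq> S"
      "\<And>t. \<exists>x\<in>cyl S l. (\<forall>i\<in>T. x i = t i) \<and> (\<forall>y\<in>?M. \<exists>i\<in>S. y i \<noteq> x i)"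
      by simp_all
    have "\<exists>y\<in>X. \<forall>i\<in>T. y i = t i" for t
    proof -
      obtain x where x: "x \<in> cyl S l" "\<forall>i\<in>T. x i = t i" "\<forall>y\<in>?M. \<exists>i\<in>S. y i \<noteq> x i"
        using T(3)[of t] by (elim bexE conjE) (rule that)
      have "x \<notin> ?M"
      proof
        assume "x \<in> ?M"
        from bspec[OF x(3) this] show False by simp
      qed
      with x(1) obtain y where y: "y \<in> X" "\<forall>i\<in>S. y i = x i" by blast
      have "\<forall>i\<in>T. y i = t i" using x(2) y(2) T(2) by auto
      then show ?thesis using y(1) by (rule bexI)
    qed
    then have "restr X T = topspace (two_pow T)"
      unfolding restr_eq_topspace_iff by blast
    then show False using assms(2) T(1) by (simp add: P2_def)
  qed
  then show ?thesis by (simp add: EM_def meager_in_restr)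
qed

theorem theorem3p7:
  shows "EM \<inter> sets borel = P2 \<inter> sets borel"
  using EM_subset_P2 analytic_P2_imp_EM borel_analytic by blast

end
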